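(* Let $m\ge2$ be an integer and let $g\colon[0,1]\to\mathbb{R}$ be continuous. Then there exists a unique function $u\colon\mathbb{T}_m\to\mathbb{R}$ satisfying $$u(x)=\min_{\substack{y,z\in\mathcal{S}(x)\\ y\neq z}}\frac{u(y)+u(z)}{2}\qquad\text{for all }x\in\mathbb{T}_m$$ and $$\lim_{x\to\pi}u(x)=g(\psi(\pi))\qquad\text{for all }\pi\in\partial\mathbb{T}_m.$$
   Context: Tree. For an integer $m\ge2$, $\mathbb{T}_m$ is the infinite $m$-branching tree whose vertices are the root $\emptyset$ and all finite sequences $(a_1,\dots,a_k)$, $k\ge1$, with $a_i\in\{0,\dots,m-1\}$. The successors of $x$ are $\mathcal{S}(x)=\{(x,i): i\in\{0,\dots,m-1\}\}$. Boundary. A branch is an infinite sequence of vertices, each followed by one of its successors, identified with $\pi=(a_1,a_2,\dots)$, $a_k\in\{0,\dots,m-1\}$; $\partial\mathbb{T}_m$ is the set of all branches. Define $\psi(\pi)=\sum_{k=1}^{\infty}a_k m^{-k}\in[0,1]$. For $u\colon\mathbb{T}_m\to\mathbb{R}$ and $\pi=(a_1,a_2,\dots)$, $\lim_{x\to\pi}u(x)$ is the limit of $u(x_k)$ as $k\to\infty$, where $x_k=(a_1,\dots,a_k)$. *)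

theory Defs
  imports "HOL-Analysis.Analysis" "HOL-Library.FuncSet"
begin

text \<open>A vertex \<open>(a\<^sub>1, \<dots>, a\<^sub>k)\<close> is the list \<open>[a\<^sub>1, \<dots>, a\<^sub>k]\<close>; the root is \<open>[]\<close>.\<close>

definition tree :: "nat \<Rightarrow> nat list set" where
  "tree m = lists {0..<m}"

definition successors :: "nat \<Rightarrow> nat list \<Rightarrow> nat list set" where
  "successors m x = {x @ [i] | i. i \<in> {0..<m}}"

text \<open>A branch \<open>(a\<^sub>1, a\<^sub>2, \<dots>)\<close> is the sequence \<open>p\<close> of its digits, indexed from \<open>0\<close>:
  \<open>p k\<close> is \<open>a\<^sub>k\<^sub>+\<^sub>1\<close>.\<close>

definition branches :: "nat \<Rightarrow> (nat \<Rightarrow> nat) set" where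
  "branches m = {p. \<forall>k. p k \<in> {0..<m}}"

definition branch_vertex :: "(nat \<Rightarrow> nat) \<Rightarrow> nat \<Rightarrow> nat list" where
  "branch_vertex p k = map p [0..<k]"

definition psi :: "nat \<Rightarrow> (nat \<Rightarrow> nat) \<Rightarrow> real" where
  "psi m p = (\<Sum>k. real (p k) / real m ^ Suc k)"

text \<open>For \<open>m \<ge> 2\<close> the set under \<open>Min\<close> is finite and nonempty.\<close>

definition min_pair_average :: "nat \<Rightarrow> (nat list \<Rightarrow> real) \<Rightarrow> nat list \<Rightarrow> real" where
  "min_pair_average m u x =
     Min {(u y + u z) / 2 | y z. y \<in> successors m x \<and> z \<in> successors m x \<and> y \<noteq> z}"

end

theory Submission
  imports Defs
begin

text \<open>
  The operator \<^const>\<open>min_pair_average\<close> is monotone, which gives existence, and its minimum is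
  attained by a pair of successors, which gives uniqueness.

  \<^emph>\<open>Uniqueness\<close> is a comparison principle (\<open>comparison_principle\<close>). If \<open>u\<close> lies below its pair
  averages and \<open>v\<close> above, take at a vertex the pair \<open>y, z\<close> that realises the minimum for \<open>v\<close>. The
  same pair bounds the minimum for \<open>u\<close> from above, so \<open>u - v\<close> at the vertex is at most the mean of
  \<open>u - v\<close> at \<open>y\<close> and \<open>z\<close>, hence at most its value at one of them. Moving to that successor again and
  again yields a branch along which \<open>u - v\<close> never decreases. Since \<open>u - v\<close> tends to \<open>0\<close> along every
  branch, it was nonpositive at the start.

  \<^emph>\<open>Existence\<close> is Perron's method. Let \<open>h x\<close> and \<open>H x\<close> be the infimum and the supremum of
  the boundary data over the branches through \<open>x\<close>. Passing to a successor shrinks the set of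
  branches, so \<open>h\<close> grows and \<open>H\<close> falls along the tree: \<open>h\<close> is a subsolution and \<open>H\<close> a
  supersolution. The supremum of all subsolutions between them is then a solution, by the
  Knaster--Tarski argument (\<open>solution_between\<close>). It inherits the boundary values because both \<open>h\<close> and
  \<open>H\<close> converge to the datum along each branch (\<open>solution_of_continuous_boundary_data\<close>).

  The function \<open>g\<close> enters only through \<open>g \<circ> psi m\<close>, which is bounded and continuous on the
  space of branches, since branches that share \<open>k\<close> digits have images at distance at most
  \<open>m\<^sup>-\<^sup>k\<close> (\<open>psi_dist_le\<close>).
\<close>

section \<open>The pair average as a monotone operator\<close>

lemma successor_in_tree:
  assumes "x \<in> tree m" "y \<in> successors m x"
  shows "y \<in> tree m"
  using assms by (auto simp: tree_def successors_def)

lemma finite_pair_averages: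
  "finite {(u y + u z) / (2::real) | y z. y \<in> successors m x \<and> z \<in> successors m x \<and> y \<noteq> z}"
proof -
  have "finite (successors m x)"
    by (simp add: successors_def Setcompr_eq_image)
  then have "finite ((\<lambda>(y, z). (u y + u z) / 2) ` (successors m x \<times> successors m x))"
    by simp
  then show ?thesis
    by (rule rev_finite_subset) fast
qed

lemma min_pair_average_le:
  assumes "y \<in> successors m x" "z \<in> successors m x" "y \<noteq> z"
  shows "min_pair_average m u x \<le> (u y + u z) / 2"
  unfolding min_pair_average_def
  by (rule Min_le[OF finite_pair_averages]) (use assms in blast)

lemma min_pair_average_attained:
  assumes "m \<ge> 2"
  obtains y z where "y \<in> successors m x" "z \<in> successors m x" "y \<noteq> z"
    "min_pair_average m u x = (u y + u z) / 2"
proof -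
  let ?A = "{(u y + u z) / 2 | y z. y \<in> successors m x \<and> z \<in> successors m x \<and> y \<noteq> z}"
  have "x @ [0] \<in> successors m x" "x @ [1] \<in> successors m x" "x @ [0] \<noteq> x @ [1]"
    using assms by (auto simp: successors_def)
  then have "?A \<noteq> {}"
    by blast
  then have "min_pair_average m u x \<in> ?A"
    unfolding min_pair_average_def by (rule Min_in[OF finite_pair_averages])
  then show ?thesis
    using that by blast
qed

lemma min_pair_average_mono:
  assumes "m \<ge> 2" and le: "\<And>y. y \<in> successors m x \<Longrightarrow> u y \<le> v y"
  shows "min_pair_average m u x \<le> min_pair_average m v x"
proof -
  obtain y z where yz: "y \<in> successors m x" "z \<in> successors m x" "y \<noteq> z"
    and v: "min_pair_average m v x = (v y + v z) / 2"
    by (rule min_pair_average_attained[OF assms(1)])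
  show ?thesis
    using min_pair_average_le[OF yz, of u] le[OF yz(1)] le[OF yz(2)] v by simp
qed

lemma min_pair_average_cong:
  assumes "m \<ge> 2" and "\<And>y. y \<in> successors m x \<Longrightarrow> u y = v y"
  shows "min_pair_average m u x = min_pair_average m v x"
  using min_pair_average_mono[OF assms(1), of x u v] min_pair_average_mono[OF assms(1), of x v u] assms(2)
  by (intro antisym) simp_all

section \<open>Vertices on branches\<close>

lemma length_branch_vertex [simp]: "length (branch_vertex p k) = k"
  by (simp add: branch_vertex_def)

lemma branch_vertex_Suc: "branch_vertex p (Suc k) = branch_vertex p k @ [p k]"
  by (simp add: branch_vertex_def)

lemma branch_vertex_in_tree:
  assumes "p \<in> branches m"
  shows "branch_vertex p k \<in> tree m"
  using assms by (auto simp: branches_def tree_def branch_vertex_def)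

lemma branch_vertex_eq_iff: "branch_vertex p k = branch_vertex q k \<longleftrightarrow> (\<forall>i<k. p i = q i)"
  by (auto simp: branch_vertex_def)

text \<open>Converts choices of successors into a branch: the branch first reads off the digits of \<open>x\<close>
  and from there on takes the digit that \<open>d\<close> prescribes at the vertex reached so far.\<close>

lemma branch_following:
  assumes x: "x \<in> tree m" and d: "\<And>y. y \<in> tree m \<Longrightarrow> d y < m"
  obtains p where "p \<in> branches m" "branch_vertex p (length x) = x"
    "\<And>k. k \<ge> length x \<Longrightarrow> p k = d (branch_vertex p k)"
proof -
  define s where "s k = ((\<lambda>y. y @ [d y]) ^^ k) x" for k
  have s_0: "s 0 = x" and s_Suc: "s (Suc k) = s k @ [d (s k)]" for k
    by (simp_all add: s_def)
  have s_tree: "s k \<in> tree m" for k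
    using x d by (induction k) (auto simp: s_0 s_Suc tree_def)
  have len: "length (s k) = length x + k" for k
    by (induction k) (auto simp: s_0 s_Suc)
  define p where "p k = (if k < length x then x ! k else d (s (k - length x)))" for k
  have "p k < m" for k
  proof (cases "k < length x")
    case True
    then have "x ! k \<in> set x" by simp
    then show ?thesis using True x by (auto simp: p_def tree_def)
  qed (use d s_tree in \<open>auto simp: p_def\<close>)
  then have branch: "p \<in> branches m"
    by (simp add: branches_def)
  have start: "branch_vertex p (length x) = x"
    by (rule nth_equalityI) (simp_all add: branch_vertex_def p_def)
  have tail: "p (length x + k) = d (s k)" for k
    by (simp add: p_def)
  have vertex: "branch_vertex p (length x + k) = s k" for k
    by (induction k) (simp_all add: start s_0 s_Suc branch_vertex_Suc tail)
  have "p k = d (branch_vertex p k)" if "k \<ge> length x" for k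
    using vertex[of "k - length x"] tail[of "k - length x"] that by simp
  then show ?thesis
    using that branch start by blast
qed

section \<open>Comparison principle\<close>

text \<open>At each vertex some successor has a gap \<open>u - v\<close> at least as large, because the pair that
  realises the minimum for \<open>v\<close> is one of the candidates for \<open>u\<close>. Only branchwise limits are
  available, without uniformity, so the argument must follow a single branch.\<close>

lemma comparison_principle:
  assumes m: "m \<ge> 2"
    and sub: "\<And>x. x \<in> tree m \<Longrightarrow> u x \<le> min_pair_average m u x"
    and super: "\<And>x. x \<in> tree m \<Longrightarrow> min_pair_average m v x \<le> v x"
    and lim: "\<And>p. p \<in> branches m \<Longrightarrow>
      (\<lambda>k. u (branch_vertex p k) - v (branch_vertex p k)) \<longlonglongrightarrow> 0"
    and x: "x \<in> tree m"
  shows "u x \<le> v x"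
proof -
  have "\<exists>i<m. u y - v y \<le> u (y @ [i]) - v (y @ [i])" if y: "y \<in> tree m" for y
  proof -
    obtain a b where ab: "a \<in> successors m y" "b \<in> successors m y" "a \<noteq> b"
      and v: "min_pair_average m v y = (v a + v b) / 2"
      by (rule min_pair_average_attained[OF m])
    have "u y - v y \<le> ((u a - v a) + (u b - v b)) / 2"
      using sub[OF y] super[OF y] min_pair_average_le[OF ab, of u] v by (simp add: field_simps)
    then have "u y - v y \<le> u a - v a \<or> u y - v y \<le> u b - v b"
      by argo
    then show ?thesis
      using ab by (auto simp: successors_def)
  qed
  then obtain d where d: "\<And>y. y \<in> tree m \<Longrightarrow> d y < m"
    and gap: "\<And>y. y \<in> tree m \<Longrightarrow> u y - v y \<le> u (y @ [d y]) - v (y @ [d y])"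
    by metis
  obtain p where p: "p \<in> branches m" "branch_vertex p (length x) = x"
    and follows: "\<And>k. k \<ge> length x \<Longrightarrow> p k = d (branch_vertex p k)"
    using branch_following[of x m d] x d by blast
  have "u x - v x \<le> u (branch_vertex p k) - v (branch_vertex p k)" if "k \<ge> length x" for k
    using that
  proof (induction k rule: dec_induct)
    case base
    then show ?case by (simp add: p)
  next
    case (step k)
    then show ?case
      using gap[OF branch_vertex_in_tree[OF p(1), of k]] follows[of k]
      by (simp add: branch_vertex_Suc)
  qed
  then have "u x - v x \<le> 0"
    by (intro LIMSEQ_le_const[OF lim[OF p(1)]]) blast
  then show ?thesis by simp
qed

section \<open>Perron's method\<close>

text \<open>The Knaster--Tarski argument, with the order interval between a subsolution and a
  supersolution in place of a complete lattice. The supremum \<open>u\<close> of the subsolutions in the interval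
  is a subsolution by monotonicity; hence so is its pair average, which therefore competes in
  the supremum and lies below \<open>u\<close>.\<close>

lemma solution_between:
  fixes h H :: "nat list \<Rightarrow> real"
  assumes m: "m \<ge> 2"
    and le: "\<And>x. x \<in> tree m \<Longrightarrow> h x \<le> H x"
    and sub: "\<And>x. x \<in> tree m \<Longrightarrow> h x \<le> min_pair_average m h x"
    and super: "\<And>x. x \<in> tree m \<Longrightarrow> min_pair_average m H x \<le> H x"
  obtains u where "\<And>x. x \<in> tree m \<Longrightarrow> u x = min_pair_average m u x"
    "\<And>x. x \<in> tree m \<Longrightarrow> h x \<le> u x" "\<And>x. x \<in> tree m \<Longrightarrow> u x \<le> H x"
proof -
  let ?F = "min_pair_average m"
  have mono: "?F v x \<le> ?F w x" if "\<And>y. y \<in> tree m \<Longrightarrow> v y \<le> w y" "x \<in> tree m" for v w x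
    using that m by (intro min_pair_average_mono) (auto intro: successor_in_tree)
  define S where "S = {w. \<forall>x\<in>tree m. h x \<le> w x \<and> w x \<le> H x \<and> w x \<le> ?F w x}"
  define u where "u x = (SUP w\<in>S. w x)" for x
  have h: "h \<in> S"
    using le sub by (simp add: S_def)
  have upper: "w x \<le> u x" if "w \<in> S" "x \<in> tree m" for w x
    unfolding u_def using that
    by (intro cSUP_upper bdd_aboveI2[of _ _ "H x"]) (auto simp: S_def)
  have least: "u x \<le> c" if "\<And>w. w \<in> S \<Longrightarrow> w x \<le> c" for x c
    unfolding u_def using h that by (intro cSUP_least) auto
  have h_le: "h x \<le> u x" if "x \<in> tree m" for x
    using upper[OF h that] .
  have le_H: "u x \<le> H x" if "x \<in> tree m" for x
    using that by (intro least) (simp add: S_def)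
  have u_sub: "u x \<le> ?F u x" if x: "x \<in> tree m" for x
  proof (rule least)
    fix w assume w: "w \<in> S"
    then have "w x \<le> ?F w x"
      using x by (simp add: S_def)
    also have "\<dots> \<le> ?F u x"
      using upper[OF w] x by (rule mono)
    finally show "w x \<le> ?F u x" .
  qed
  have "?F u \<in> S"
  proof -
    have "?F u x \<le> H x" if "x \<in> tree m" for x
      using mono[of u H x] le_H super[OF that] that by force
    moreover have "h x \<le> ?F u x" if "x \<in> tree m" for x
      using h_le[OF that] u_sub[OF that] by linarith
    moreover have "?F u x \<le> ?F (?F u) x" if "x \<in> tree m" for x
      using mono[of u "?F u" x] u_sub that by blast
    ultimately show ?thesis
      by (simp add: S_def)
  qed
  then have "u x = ?F u x" if "x \<in> tree m" for x
    using u_sub[OF that] upper[OF _ that] by (intro antisym)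
  then show ?thesis
    using that h_le le_H by blast
qed

text \<open>The hypothesis \<open>cont\<close> is continuity of \<open>f\<close> for the product topology on branches. The
  subsolution and supersolution are the extreme values of \<open>f\<close> on the cylinder of
  branches through a vertex, and continuity squeezes them together.\<close>

lemma solution_of_continuous_boundary_data:
  fixes f :: "(nat \<Rightarrow> nat) \<Rightarrow> real"
  assumes m: "m \<ge> 2"
    and bdd: "bounded (f ` branches m)"
    and cont: "\<And>p e. p \<in> branches m \<Longrightarrow> e > 0 \<Longrightarrow>
      \<exists>k. \<forall>q\<in>branches m. (\<forall>i<k. q i = p i) \<longrightarrow> \<bar>f q - f p\<bar> \<le> e"
  obtains u where "\<And>x. x \<in> tree m \<Longrightarrow> u x = min_pair_average m u x"
    "\<And>p. p \<in> branches m \<Longrightarrow> (\<lambda>k. u (branch_vertex p k)) \<longlonglongrightarrow> f p"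
proof -
  define C where "C x = {p \<in> branches m. branch_vertex p (length x) = x}" for x
  define h where "h x = (INF p\<in>C x. f p)" for x
  define H where "H x = (SUP p\<in>C x. f p)" for x
  have C_sub: "C x \<subseteq> branches m" for x
    by (auto simp: C_def)
  have "bounded (f ` C x)" for x
    by (rule bounded_subset[OF bdd image_mono[OF C_sub]])
  then have bdd_C: "bdd_below (f ` C x)" "bdd_above (f ` C x)" for x
    by (auto intro: bounded_imp_bdd_below bounded_imp_bdd_above)
  have C_ne: "C x \<noteq> {}" if x: "x \<in> tree m" for x
  proof -
    obtain p where "p \<in> branches m" "branch_vertex p (length x) = x"
      by (rule branch_following[of x m "\<lambda>_. 0"]) (use x m in auto)
    then show ?thesis
      by (auto simp: C_def)
  qed
  have C_succ: "C y \<subseteq> C x" if "y \<in> successors m x" for x y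
    using that by (auto simp: C_def successors_def branch_vertex_Suc)
  have h_H: "h x \<le> H x" if "x \<in> tree m" for x
    unfolding h_def H_def
    using C_ne[OF that] bdd_C by (metis all_not_in_conv cINF_lower cSUP_upper order_trans)
  have h_succ: "h x \<le> h y" and H_succ: "H y \<le> H x" if "x \<in> tree m" "y \<in> successors m x" for x y
    unfolding h_def H_def using C_ne[OF successor_in_tree[OF that]] C_succ[OF that(2)] bdd_C
    by (auto intro: cINF_superset_mono cSUP_subset_mono)
  have h_sub: "h x \<le> min_pair_average m h x" if x: "x \<in> tree m" for x
  proof -
    obtain y z where yz: "y \<in> successors m x" "z \<in> successors m x"
      and "min_pair_average m h x = (h y + h z) / 2"
      by (rule min_pair_average_attained[OF m])
    then show ?thesis
      using h_succ[OF x yz(1)] h_succ[OF x yz(2)] by simp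
  qed
  have H_super: "min_pair_average m H x \<le> H x" if x: "x \<in> tree m" for x
  proof -
    obtain y z where yz: "y \<in> successors m x" "z \<in> successors m x"
      and "min_pair_average m H x = (H y + H z) / 2"
      by (rule min_pair_average_attained[OF m])
    then show ?thesis
      using H_succ[OF x yz(1)] H_succ[OF x yz(2)] by simp
  qed
  obtain u where sol: "\<And>x. x \<in> tree m \<Longrightarrow> u x = min_pair_average m u x"
    and bounds: "\<And>x. x \<in> tree m \<Longrightarrow> h x \<le> u x" "\<And>x. x \<in> tree m \<Longrightarrow> u x \<le> H x"
    using solution_between[of m h H] m h_H h_sub H_super by blast
  have "(\<lambda>k. u (branch_vertex p k)) \<longlonglongrightarrow> f p" if p: "p \<in> branches m" for p
  proof (rule LIMSEQ_I)
    fix r :: real assume "r > 0"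
    then obtain k where k: "\<And>q. q \<in> branches m \<Longrightarrow> \<forall>i<k. q i = p i \<Longrightarrow> \<bar>f q - f p\<bar> \<le> r / 2"
      using cont[OF p, of "r / 2"] by auto
    have "norm (u (branch_vertex p n) - f p) < r" if "n \<ge> k" for n
    proof -
      let ?x = "branch_vertex p n"
      have x: "?x \<in> tree m"
        by (rule branch_vertex_in_tree[OF p])
      have bound: "\<bar>f q - f p\<bar> \<le> r / 2" if "q \<in> C ?x" for q
        using that \<open>n \<ge> k\<close> by (intro k) (auto simp: C_def branch_vertex_eq_iff)
      have close: "f p - r / 2 \<le> f q" "f q \<le> f p + r / 2" if "q \<in> C ?x" for q
        using bound[OF that] by linarith+
      have "f p - r / 2 \<le> h ?x"
        unfolding h_def by (intro cINF_greatest C_ne x close)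
      moreover have "H ?x \<le> f p + r / 2"
        unfolding H_def by (intro cSUP_least C_ne x close)
      ultimately show ?thesis
        using bounds[OF x] \<open>r > 0\<close> by (simp add: abs_less_iff)
    qed
    then show "\<exists>k. \<forall>n\<ge>k. norm (u (branch_vertex p n) - f p) < r"
      by blast
  qed
  then show ?thesis
    using that sol by blast
qed

section \<open>Base-\<open>m\<close> expansions\<close>

text \<open>The tail of the expansion with all digits \<open>m - 1\<close>.\<close>

lemma max_digit_tail_sums:
  assumes "m \<ge> 2"
  shows "(\<lambda>j. (real m - 1) / real m ^ Suc (j + k)) sums (1 / real m ^ k)"
proof -
  have "(\<lambda>j. (real m - 1) / real m ^ Suc k * (1 / real m) ^ j) sums
      ((real m - 1) / real m ^ Suc k * (1 / (1 - 1 / real m)))"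
    using assms by (intro sums_mult geometric_sums) simp
  moreover have "(real m - 1) / real m ^ Suc k * (1 / real m) ^ j = (real m - 1) / real m ^ Suc (j + k)" for j
    by (simp add: power_add power_one_over field_simps)
  moreover have "(real m - 1) / real m ^ Suc k * (1 / (1 - 1 / real m)) = 1 / real m ^ k"
    using assms by (simp add: field_simps)
  ultimately show ?thesis
    by simp
qed

lemma digit_le:
  assumes "p \<in> branches m"
  shows "real (p k) \<le> real m - 1"
proof -
  have "Suc (p k) \<le> m"
    using assms by (auto simp: branches_def Suc_le_eq)
  then show ?thesis
    by linarith
qed

lemma psi_summable:
  assumes "m \<ge> 2" "p \<in> branches m"
  shows "summable (\<lambda>k. real (p k) / real m ^ Suc k)"
proof (rule summable_comparison_test')
  show "summable (\<lambda>k. (real m - 1) / real m ^ Suc k)"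
    using max_digit_tail_sums[OF assms(1), of 0] by (simp add: sums_iff)
  show "norm (real (p k) / real m ^ Suc k) \<le> (real m - 1) / real m ^ Suc k" if "k \<ge> 0" for k
    using digit_le[OF assms(2), of k] by (simp add: divide_right_mono)
qed

lemma psi_in_unit_interval:
  assumes "m \<ge> 2" "p \<in> branches m"
  shows "psi m p \<in> {0..1}"
proof -
  have "psi m p \<ge> 0"
    unfolding psi_def by (intro suminf_nonneg psi_summable assms) simp
  moreover have "psi m p \<le> 1"
    unfolding psi_def
  proof (rule sums_le[OF _ summable_sums[OF psi_summable[OF assms]]])
    show "(\<lambda>k. (real m - 1) / real m ^ Suc k) sums 1"
      using max_digit_tail_sums[OF assms(1), of 0] by simp
  qed (intro divide_right_mono digit_le assms, simp)
  ultimately show ?thesis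
    by simp
qed

text \<open>The first \<open>k\<close> digits cancel, and the digitwise differences in the tail are at most \<open>m - 1\<close>.\<close>

lemma psi_dist_le:
  assumes m: "m \<ge> 2" and p: "p \<in> branches m" and q: "q \<in> branches m"
    and agree: "\<And>i. i < k \<Longrightarrow> p i = q i"
  shows "\<bar>psi m p - psi m q\<bar> \<le> 1 / real m ^ k"
proof -
  define t where "t j = (real (p j) - real (q j)) / real m ^ Suc j" for j
  have "t sums (psi m p - psi m q)"
    unfolding t_def psi_def diff_divide_distrib
    by (intro sums_diff summable_sums psi_summable m p q)
  moreover have "(\<Sum>j<k. t j) = 0"
    by (simp add: t_def agree)
  ultimately have sums: "(\<lambda>j. t (j + k)) sums (psi m p - psi m q)"
    by (simp add: sums_iff_shift)
  have bound: "\<bar>t j\<bar> \<le> (real m - 1) / real m ^ Suc j" for j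
  proof -
    have "\<bar>real (p j) - real (q j)\<bar> \<le> real m - 1"
      using digit_le[OF p, of j] digit_le[OF q, of j] by linarith
    then show ?thesis
      by (simp add: t_def divide_right_mono)
  qed
  show ?thesis
    using norm_sums_le[OF sums max_digit_tail_sums[OF m, of k]] bound by simp
qed

section \<open>The Dirichlet problem\<close>

theorem theorem1p5:
  fixes m :: nat and g :: "real \<Rightarrow> real"
  assumes "m \<ge> 2"
    and "continuous_on {0..1} g"
  shows "\<exists>!u. u \<in> tree m \<rightarrow>\<^sub>E (UNIV :: real set)
    \<and> (\<forall>x\<in>tree m. u x = min_pair_average m u x)
    \<and> (\<forall>p\<in>branches m. (\<lambda>k. u (branch_vertex p k)) \<longlonglongrightarrow> g (psi m p))"
proof (rule ex_ex1I)
  have "bounded (g ` {0..1})"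
    using assms(2) by (intro compact_imp_bounded compact_continuous_image) auto
  then have bdd: "bounded ((\<lambda>p. g (psi m p)) ` branches m)"
    by (rule bounded_subset) (use psi_in_unit_interval[OF assms(1)] in blast)
  have cont: "\<exists>k. \<forall>q\<in>branches m. (\<forall>i<k. q i = p i) \<longrightarrow> \<bar>g (psi m q) - g (psi m p)\<bar> \<le> e"
    if p: "p \<in> branches m" and "e > 0" for p e
  proof -
    obtain d where "d > 0"
      and d: "\<And>t. t \<in> {0..1} \<Longrightarrow> dist t (psi m p) < d \<Longrightarrow> dist (g t) (g (psi m p)) < e"
      using assms(2)[unfolded continuous_on_iff, rule_format,
          OF psi_in_unit_interval[OF assms(1) p] \<open>e > 0\<close>] by blast
    obtain k where "(1 / real m) ^ k < d"
      using real_arch_pow_inv[OF \<open>d > 0\<close>, of "1 / real m"] assms(1) by auto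
    then have k: "1 / real m ^ k < d"
      by (simp add: power_one_over)
    have "\<bar>g (psi m q) - g (psi m p)\<bar> \<le> e" if "q \<in> branches m" "\<forall>i<k. q i = p i" for q
    proof -
      have "dist (psi m q) (psi m p) < d"
        using psi_dist_le[OF assms(1) that(1) p, of k] that(2) k by (simp add: dist_real_def)
      from d[OF psi_in_unit_interval[OF assms(1) that(1)] this] show ?thesis
        by (simp add: dist_real_def)
    qed
    then show ?thesis
      by blast
  qed
  obtain u where sol: "\<And>x. x \<in> tree m \<Longrightarrow> u x = min_pair_average m u x"
    and lim: "\<And>p. p \<in> branches m \<Longrightarrow> (\<lambda>k. u (branch_vertex p k)) \<longlonglongrightarrow> g (psi m p)"
    using solution_of_continuous_boundary_data[of m "\<lambda>p. g (psi m p)"] assms(1) bdd cont by blast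
  let ?u = "restrict u (tree m)"
  have "?u x = min_pair_average m ?u x" if x: "x \<in> tree m" for x
  proof -
    have "min_pair_average m ?u x = min_pair_average m u x"
      using x by (intro min_pair_average_cong assms(1)) (simp add: successor_in_tree)
    then show ?thesis
      using sol[OF x] x by simp
  qed
  moreover have "(\<lambda>k. ?u (branch_vertex p k)) \<longlonglongrightarrow> g (psi m p)" if "p \<in> branches m" for p
    using lim[OF that] that by (simp add: branch_vertex_in_tree)
  moreover have "?u \<in> tree m \<rightarrow>\<^sub>E UNIV"
    by simp
  ultimately show "\<exists>u. u \<in> tree m \<rightarrow>\<^sub>E (UNIV :: real set)
    \<and> (\<forall>x\<in>tree m. u x = min_pair_average m u x)
    \<and> (\<forall>p\<in>branches m. (\<lambda>k. u (branch_vertex p k)) \<longlonglongrightarrow> g (psi m p))"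
    by blast
next
  fix u v
  assume u: "u \<in> tree m \<rightarrow>\<^sub>E (UNIV :: real set)
    \<and> (\<forall>x\<in>tree m. u x = min_pair_average m u x)
    \<and> (\<forall>p\<in>branches m. (\<lambda>k. u (branch_vertex p k)) \<longlonglongrightarrow> g (psi m p))"
    and v: "v \<in> tree m \<rightarrow>\<^sub>E (UNIV :: real set)
    \<and> (\<forall>x\<in>tree m. v x = min_pair_average m v x)
    \<and> (\<forall>p\<in>branches m. (\<lambda>k. v (branch_vertex p k)) \<longlonglongrightarrow> g (psi m p))"
  have le: "w x \<le> w' x"
    if sol: "\<forall>x\<in>tree m. w x = min_pair_average m w x" "\<forall>x\<in>tree m. w' x = min_pair_average m w' x"
      and lim: "\<forall>p\<in>branches m. (\<lambda>k. w (branch_vertex p k)) \<longlonglongrightarrow> g (psi m p)"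
        "\<forall>p\<in>branches m. (\<lambda>k. w' (branch_vertex p k)) \<longlonglongrightarrow> g (psi m p)"
      and x: "x \<in> tree m" for w w' x
  proof (rule comparison_principle[OF assms(1) _ _ _ x])
    show "w y \<le> min_pair_average m w y" "min_pair_average m w' y \<le> w' y" if "y \<in> tree m" for y
      using sol that by (metis order_refl)+
    show "(\<lambda>k. w (branch_vertex p k) - w' (branch_vertex p k)) \<longlonglongrightarrow> 0" if "p \<in> branches m" for p
      using tendsto_diff[OF lim[THEN bspec, OF that]] by simp
  qed
  have "u x = v x" if "x \<in> tree m" for x
    using le[of u v x] le[of v u x] u v that by (intro antisym) blast+
  then show "u = v"
    using u v by (blast intro: PiE_ext)
qed

end
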